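(* (i) Let $k$ be an odd positive integer. Then for any integer $n\geq k+1$, $$k+\frac{k+1}{2}\left(\log_2\frac{n+1}{k+1}-1\right)< \chi_{kscf}(H_n)< k+\frac{k+1}{2}\left(1+\log_2\frac{n+1}{k+1}\right).$$ (ii) Let $k$ be an even positive integer. Then for any integer $n\geq k+2$, $$k-1+\frac{k}{2}\left(\log_2\frac{n+1}{k}-1\right)< \chi_{kscf}(H_n)< 1+k+\frac{k+2}{2}\left(1+\log_2\frac{n+1}{k+2}\right).$$
   Context: For a positive integer $n$, let $H_n=(V_n,\mathcal{E}_n)$ be the hypergraph with vertex set $V_n=\{1,2,\dots,n\}$ and hyperedge set $\mathcal{E}_n$ consisting of all non-empty subsets of $V_n$ made of consecutive integers, i.e. all sets $\{i,i+1,\dots,j\}$ with $1\le i\le j\le n$. For a positive integer $k$, a coloring $\phi:V\to\{1,\ldots,m\}$ of a hypergraph $H=(V,\mathcal{E})$ is called a $k$-SCF-coloring ($k$-strong-conflict-free coloring) if for every $e\in\mathcal{E}$ with $|e|\geq k$ there are at least $k$ colors which appear exactly once in $e$ (i.e. are the color of exactly one vertex of $e$), and for every $e\in\mathcal{E}$ with $|e|<k$ all vertices of $e$ have different colors. The chromatic number $\chi_{kscf}(H)$ is the smallest number of colors in any $k$-SCF-coloring of $H$. *)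

theory Defs
  imports Complex_Main
begin

type_synonym 'a hypergraph = "'a set \<times> 'a set set"

definition interval_hypergraph :: "nat \<Rightarrow> nat hypergraph" where
  "interval_hypergraph n = ({1..n}, {{i..j} | i j. 1 \<le> i \<and> i \<le> j \<and> j \<le> n})"

text \<open>Hypergraphs are meant to be finite; \<^const>\<open>card\<close> is only used on finite hyperedges.\<close>

definition kscf_coloring :: "nat \<Rightarrow> 'a hypergraph \<Rightarrow> nat \<Rightarrow> ('a \<Rightarrow> nat) \<Rightarrow> bool" where
  "kscf_coloring k H m \<phi> \<longleftrightarrow>
     \<phi> ` fst H \<subseteq> {1..m} \<and>
     (\<forall>e \<in> snd H.
        (card e \<ge> k \<longrightarrow> card {c \<in> {1..m}. \<exists>!v. v \<in> e \<and> \<phi> v = c} \<ge> k) \<and>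
        (card e < k \<longrightarrow> inj_on \<phi> e))"

definition chi_kscf :: "nat \<Rightarrow> 'a hypergraph \<Rightarrow> nat" where
  "chi_kscf k H = (LEAST m. \<exists>\<phi>. kscf_coloring k H m \<phi>)"

end

theory Submission imports Defs begin

text \<open>
  Both bounds rest on one doubling phenomenon: for odd \<open>k = 2 * s - 1\<close>, every \<open>s\<close> additional
  colours double (up to one vertex) the length of the longest path of consecutive integers that can
  be coloured.

  For the lower bound, take a coloured interval of length at least \<open>k\<close>. It has at least \<open>2 * s - 1\<close> vertices
  whose colour occurs only once; remove the median one, \<open>p\<close>. The part to the left of \<open>p\<close> avoids the
  colours of \<open>p\<close> and of at least \<open>s - 1\<close> unique vertices to its right, and symmetrically for the part to
  the right of \<open>p\<close>. So both parts use at least \<open>s\<close> colours less, and induction gives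
  \<open>n + 1 < s * 2 powr ((m + 1) / s)\<close> for \<open>m\<close> colours (\<open>strong_cf_length_bound\<close>). The
  intervals shorter than \<open>k\<close> form the base case, where \<open>n \<le> m\<close> and \<open>x < 2 powr x\<close> suffices.

  For the upper bound, spread a coloured path of length \<open>n\<close> out over the even positions of
  \<open>{1..2 * n + 1}\<close> and give the odd positions \<open>s\<close> new colours cyclically (\<open>strong_cf_double\<close>).
  An interval with \<open>a\<close> even and \<open>b \<le> a + 1\<close> odd positions either inherits \<open>k\<close> unique
  colours from the old path, or has \<open>a\<close> of them there and, when \<open>b > s\<close>, at least \<open>2 * s - b\<close>
  among the new ones, together at least \<open>2 * s - 1 = k\<close>.

  For even \<open>k\<close> the estimates follow from those for \<open>k - 1\<close> and \<open>k + 1\<close>, since a \<open>(k + 1)\<close>-strong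
  conflict-free colouring is also a \<open>k\<close>-strong one.
\<close>

section \<open>Uniquely coloured vertices\<close>

definition solo :: "('a \<Rightarrow> 'b) \<Rightarrow> 'a set \<Rightarrow> 'a set" where
  "solo f A = {v \<in> A. \<forall>w \<in> A. f w = f v \<longrightarrow> w = v}"

text \<open>
  Counting unique vertices instead of unique colours merges the two clauses on large and small
  hyperedges into one inequality: a hyperedge with fewer than \<open>k\<close> vertices is rainbow exactly if all
  of its vertices are unique. Half-open intervals make the empty hyperedge harmless and let an
  interval be cut at a vertex without subtraction.
\<close>

definition strong_cf :: "nat \<Rightarrow> (nat \<Rightarrow> 'b) \<Rightarrow> nat \<Rightarrow> nat \<Rightarrow> bool" where
  "strong_cf k f l h \<longleftrightarrow>
     (\<forall>i j. l \<le> i \<and> j \<le> h \<longrightarrow> min k (j - i) \<le> card (solo f {i..<j}))"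

lemma solo_subset: "solo f A \<subseteq> A"
  by (auto simp: solo_def)

lemma finite_solo: "finite A \<Longrightarrow> finite (solo f A)"
  using finite_subset[OF solo_subset] .

lemma inj_on_solo: "inj_on f (solo f A)"
  by (auto simp: solo_def inj_on_def)

lemma solo_eq_iff_inj_on: "solo f A = A \<longleftrightarrow> inj_on f A"
  by (auto simp: solo_def inj_on_def)

lemma inj_on_iff_card_solo:
  assumes "finite A"
  shows "inj_on f A \<longleftrightarrow> card A \<le> card (solo f A)"
  using card_seteq[OF assms solo_subset] solo_eq_iff_inj_on by (metis order_refl)

lemma card_unique_colors:
  assumes "f ` A \<subseteq> C"
  shows "card {c \<in> C. \<exists>!v. v \<in> A \<and> f v = c} = card (solo f A)"
proof -
  have "{c \<in> C. \<exists>!v. v \<in> A \<and> f v = c} = f ` solo f A"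
    using assms by (auto simp: solo_def)
  then show ?thesis
    by (simp add: card_image inj_on_solo)
qed

lemma strong_cf_subinterval:
  "strong_cf k f l h \<Longrightarrow> l \<le> l' \<Longrightarrow> h' \<le> h \<Longrightarrow> strong_cf k f l' h'"
  by (auto simp: strong_cf_def)

lemma strong_cf_antimono:
  "strong_cf k f l h \<Longrightarrow> k' \<le> k \<Longrightarrow> strong_cf k' f l h"
  unfolding strong_cf_def by (meson le_trans min.mono order_refl)

lemma strong_cf_id: "strong_cf k (\<lambda>v. v) l h"
proof -
  have "solo (\<lambda>v. v) A = A" for A :: "nat set"
    by (simp add: solo_eq_iff_inj_on inj_on_def)
  then show ?thesis
    by (simp add: strong_cf_def)
qed

lemma kscf_coloring_interval_iff:
  "kscf_coloring k (interval_hypergraph n) m f \<longleftrightarrow>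
     f ` {1..n} \<subseteq> {1..m} \<and> strong_cf k f 1 (Suc n)"
proof -
  have edge: "((card e \<ge> k \<longrightarrow> card {c \<in> {1..m}. \<exists>!v. v \<in> e \<and> f v = c} \<ge> k) \<and>
        (card e < k \<longrightarrow> inj_on f e)) \<longleftrightarrow> min k (card e) \<le> card (solo f e)"
    if "f ` {1..n} \<subseteq> {1..m}" "e \<subseteq> {1..n}" for e
  proof -
    have "finite e" "f ` e \<subseteq> {1..m}"
      using that finite_subset[OF that(2)] by auto
    then show ?thesis
      by (simp only: card_unique_colors inj_on_iff_card_solo min_def) auto
  qed
  have cover: "(\<forall>e \<in> snd (interval_hypergraph n). min k (card e) \<le> card (solo f e))
      \<longleftrightarrow> strong_cf k f 1 (Suc n)"
  proof
    assume L: "\<forall>e \<in> snd (interval_hypergraph n). min k (card e) \<le> card (solo f e)"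
    show "strong_cf k f 1 (Suc n)"
      unfolding strong_cf_def
    proof (intro allI impI)
      fix i j :: nat
      assume ij: "1 \<le> i \<and> j \<le> Suc n"
      show "min k (j - i) \<le> card (solo f {i..<j})"
      proof (cases "i < j")
        case True
        then have e: "{i..<j} = {i..j - 1}" by auto
        have "{i..<j} \<in> snd (interval_hypergraph n)"
          unfolding e interval_hypergraph_def using ij True by force
        then show ?thesis using L by fastforce
      qed simp
    qed
  next
    assume R: "strong_cf k f 1 (Suc n)"
    show "\<forall>e \<in> snd (interval_hypergraph n). min k (card e) \<le> card (solo f e)"
    proof
      fix e assume "e \<in> snd (interval_hypergraph n)"
      then obtain i j where "e = {i..<Suc j}" "1 \<le> i" "j \<le> n"
        by (auto simp: interval_hypergraph_def atLeastLessThanSuc_atLeastAtMost)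
      then show "min k (card e) \<le> card (solo f e)"
        using R by (simp add: strong_cf_def)
    qed
  qed
  have sub: "e \<subseteq> {1..n}" if "e \<in> snd (interval_hypergraph n)" for e
    using that by (auto simp: interval_hypergraph_def)
  have "fst (interval_hypergraph n) = {1..n}"
    by (simp add: interval_hypergraph_def)
  moreover have "(\<forall>e \<in> snd (interval_hypergraph n).
        (card e \<ge> k \<longrightarrow> card {c \<in> {1..m}. \<exists>!v. v \<in> e \<and> f v = c} \<ge> k) \<and>
        (card e < k \<longrightarrow> inj_on f e)) \<longleftrightarrow> strong_cf k f 1 (Suc n)"
    if "f ` {1..n} \<subseteq> {1..m}"
    unfolding cover[symmetric] by (rule ball_cong[OF refl edge[OF that sub]])
  ultimately show ?thesis
    unfolding kscf_coloring_def by argo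
qed

section \<open>Splitting an interval at the median unique vertex\<close>

text \<open>
  The least \<open>p\<close> with at least \<open>s\<close> elements of \<open>S\<close> below or at it works: fewer than \<open>s\<close> of
  the at least \<open>2 * s - 1\<close> elements lie strictly below it.
\<close>

lemma median_exists:
  fixes S :: "nat set"
  assumes "finite S" "2 * s - 1 \<le> card S" "0 < s"
  obtains p where "s \<le> card {q \<in> S. q \<le> p}" "s \<le> card {q \<in> S. p \<le> q}"
proof -
  define P where "P p \<longleftrightarrow> s \<le> card {q \<in> S. q \<le> p}" for p
  have "{q \<in> S. q \<le> Max S} = S"
    using assms by auto
  then have "P (Max S)"
    unfolding P_def using assms by simp
  define p where "p = (LEAST p. P p)"
  have p: "P p"
    unfolding p_def using \<open>P (Max S)\<close> by (rule LeastI)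
  have below: "card {q \<in> S. q < p} \<le> s - 1"
  proof (cases p)
    case (Suc r)
    then have "\<not> P r"
      unfolding p_def by (metis lessI not_less_Least)
    then show ?thesis
      unfolding Suc P_def less_Suc_eq_le by simp
  qed simp
  have "card S = card ({q \<in> S. q < p} \<union> {q \<in> S. p \<le> q})"
    by (rule arg_cong[of _ _ card]) auto
  also have "\<dots> \<le> card {q \<in> S. q < p} + card {q \<in> S. p \<le> q}"
    by (rule card_Un_le)
  finally have "s \<le> card {q \<in> S. p \<le> q}"
    using below assms by linarith
  with p show ?thesis
    using that unfolding P_def by blast
qed

text \<open>
  A colour of a unique vertex outside of \<open>B\<close> does not occur in \<open>B\<close>.
\<close>

lemma card_image_avoiding_solo:
  assumes "finite I" "B \<subseteq> I" "T \<subseteq> solo f I" "B \<inter> T = {}"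
  shows "card (f ` B) + card T \<le> card (f ` I)"
proof -
  have "T \<subseteq> I"
    using assms(3) solo_subset by (rule subset_trans)
  have "f b \<noteq> f t" if "b \<in> B" "t \<in> T" for b t
  proof
    assume "f b = f t"
    then have "b = t"
      using assms(2,3) that by (auto simp: solo_def)
    then show False
      using assms(4) that by blast
  qed
  then have "f ` B \<inter> f ` T = {}"
    by blast
  moreover have "finite B" "finite T"
    using finite_subset[OF _ assms(1)] assms(2) \<open>T \<subseteq> I\<close> by simp_all
  moreover have "card (f ` T) = card T"
    using inj_on_subset[OF inj_on_solo assms(3)] by (rule card_image)
  ultimately have "card (f ` B) + card T = card (f ` B \<union> f ` T)"
    by (simp add: card_Un_disjoint)
  also have "\<dots> \<le> card (f ` I)"
    using assms(1,2) \<open>T \<subseteq> I\<close> by (intro card_mono) auto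
  finally show ?thesis .
qed

lemma less_two_powr: "x < 2 powr x" for x :: real
proof (cases "x < 1")
  case True
  show ?thesis
  proof (cases "x \<le> 0")
    case False
    then have "1 \<le> 2 powr x" by (simp add: ge_one_powr_ge_zero)
    then show ?thesis using True by linarith
  next
    case True
    then show ?thesis by (metis le_less_trans powr_gt_zero zero_neq_numeral)
  qed
next
  case False
  have "real (nat \<lfloor>x\<rfloor>) + 1 \<le> 2 ^ nat \<lfloor>x\<rfloor>"
    using less_exp[of "nat \<lfloor>x\<rfloor>"]
    by (metis Suc_leI of_nat_Suc add.commute of_nat_le_iff of_nat_numeral of_nat_power)
  also have "\<dots> = 2 powr real (nat \<lfloor>x\<rfloor>)"
    by (simp add: powr_realpow)
  also have "\<dots> \<le> 2 powr x"
    using False by (intro powr_mono) auto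
  finally show ?thesis
    using False by linarith
qed

text \<open>
  The bound is \<open>g m = s * 2 powr ((m + 1) / s)\<close>, chosen to satisfy \<open>g (m + s) = 2 * g m\<close> exactly, so
  that removing the median vertex is a lossless induction step.
\<close>

lemma strong_cf_length_bound:
  assumes "strong_cf (2 * s - 1) f a b" "0 < s"
  shows "real (b - a) + 1 < real s * 2 powr ((real (card (f ` {a..<b})) + 1) / real s)"
  using assms(1)
proof (induction "b - a" arbitrary: a b rule: less_induct)
  case less
  let ?I = "{a..<b}"
  let ?m = "card (f ` ?I)"
  define S where "S = solo f ?I"
  have cardS: "min (2 * s - 1) (b - a) \<le> card S"
    using less.prems unfolding strong_cf_def S_def by blast
  show ?case
  proof (cases "b - a < 2 * s - 1")
    case True
    then have "inj_on f ?I"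
      using cardS by (simp add: inj_on_iff_card_solo S_def)
    then have "real (b - a) + 1 = real s * ((real ?m + 1) / real s)"
      using \<open>0 < s\<close> by (simp add: card_image)
    also have "\<dots> < real s * 2 powr ((real ?m + 1) / real s)"
      using less_two_powr \<open>0 < s\<close> by (intro mult_strict_left_mono) auto
    finally show ?thesis .
  next
    case False
    have "finite S" unfolding S_def by (simp add: finite_solo)
    then obtain p where p: "s \<le> card {q \<in> S. q \<le> p}" "s \<le> card {q \<in> S. p \<le> q}"
      using cardS False \<open>0 < s\<close> median_exists[of S s] by (metis min.absorb1 not_less)
    have "{q \<in> S. q \<le> p} \<noteq> {}" "{q \<in> S. p \<le> q} \<noteq> {}"
      using p \<open>0 < s\<close> by (metis card.empty not_le)+
    then have ab: "a \<le> p" "p < b"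
      using solo_subset[of f ?I] unfolding S_def by force+
    have "card (f ` {a..<p}) + card {q \<in> S. p \<le> q} \<le> ?m"
      by (rule card_image_avoiding_solo) (use ab in \<open>auto simp: S_def\<close>)
    moreover have "card (f ` {Suc p..<b}) + card {q \<in> S. q \<le> p} \<le> ?m"
      by (rule card_image_avoiding_solo) (use ab in \<open>auto simp: S_def\<close>)
    ultimately have colors: "card (f ` {a..<p}) + s \<le> ?m" "card (f ` {Suc p..<b}) + s \<le> ?m"
      using p by linarith+
    let ?B = "real s * 2 powr ((real ?m + 1) / real s)"
    \<comment> \<open>The bound for \<open>m' \<le> m - s\<close> colours is at most half of the bound for \<open>m\<close> colours.\<close>
    have half: "2 * (real s * 2 powr ((real m' + 1) / real s)) \<le> ?B" if "m' + s \<le> ?m" for m'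
    proof -
      have "2 * 2 powr ((real m' + 1) / real s) = 2 powr ((real m' + 1) / real s + 1)"
        by (simp add: powr_add)
      also have "\<dots> = 2 powr ((real (m' + s) + 1) / real s)"
        using \<open>0 < s\<close> by (simp add: field_simps)
      also have "\<dots> \<le> 2 powr ((real ?m + 1) / real s)"
        using that by (intro powr_mono divide_right_mono) linarith+
      finally show ?thesis
        using \<open>0 < s\<close> by (simp add: mult.left_commute)
    qed
    have "real (p - a) + 1 < real s * 2 powr ((real (card (f ` {a..<p})) + 1) / real s)"
      using ab by (intro less.hyps strong_cf_subinterval[OF less.prems]) auto
    moreover have "real (b - Suc p) + 1
        < real s * 2 powr ((real (card (f ` {Suc p..<b})) + 1) / real s)"
      using ab by (intro less.hyps strong_cf_subinterval[OF less.prems]) auto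
    moreover have "real (b - a) + 1 = (real (p - a) + 1) + (real (b - Suc p) + 1)"
      using ab by auto
    ultimately show ?thesis
      using half[OF colors(1)] half[OF colors(2)] by linarith
  qed
qed

section \<open>Doubling a coloured path\<close>

text \<open>
  The vertices with no other member of their residue class in an interval are those whose two
  neighbours at distance \<open>s\<close> fall outside of it; for \<open>b > s\<close> they form its middle part.
\<close>

lemma card_solo_mod:
  assumes "0 < s"
  shows "min b (2 * s - b) \<le> card (solo (\<lambda>x. x mod s) {c..<c + b})"
proof -
  let ?M = "{max c (c + b - s)..<min (c + b) (c + s)}"
  have "?M \<subseteq> solo (\<lambda>x. x mod s) {c..<c + b}"
  proof
    fix x assume x: "x \<in> ?M"
    have "w = x" if w: "w \<in> {c..<c + b}" "w mod s = x mod s" for w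
    proof -
      have near: "w < x + s" "x < w + s"
        using x w(1) unfolding atLeastLessThan_iff by linarith+
      have "s dvd w - x \<or> w \<le> x" "s dvd x - w \<or> x \<le> w"
        using w(2) by (metis mod_eq_dvd_iff_nat nat_le_linear)+
      then show "w = x"
        using near dvd_imp_le[of s "w - x"] dvd_imp_le[of s "x - w"] by linarith
    qed
    then show "x \<in> solo (\<lambda>x. x mod s) {c..<c + b}"
      using x unfolding solo_def by simp
  qed
  then have "card ?M \<le> card (solo (\<lambda>x. x mod s) {c..<c + b})"
    by (intro card_mono finite_solo) auto
  moreover have "min b (2 * s - b) \<le> card ?M"
    by (cases "b \<le> s") simp_all
  ultimately show ?thesis by linarith
qed

text \<open>
  Old and new colours are disjoint, so a vertex that is unique among the even (or among the odd)
  positions of an interval is unique in the whole interval, and the two counts add up. The period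
  \<open>s\<close> is the smallest that works: with \<open>a = 2 * s - 2\<close> and \<open>b = 2 * s - 1\<close> exactly one odd
  position is unique, which is what is needed to reach \<open>2 * s - 1\<close>.
\<close>

lemma strong_cf_double:
  assumes cf: "strong_cf (2 * s - 1) f 1 (Suc n)" and "0 < s"
    and colors: "f ` {1..n} \<subseteq> {1..m}"
  defines "g \<equiv> \<lambda>v. if even v then f (v div 2) else m + 1 + (v div 2) mod s"
  shows "strong_cf (2 * s - 1) g 1 (Suc (2 * n + 1))"
    and "g ` {1..2 * n + 1} \<subseteq> {1..m + s}"
proof -
  show "g ` {1..2 * n + 1} \<subseteq> {1..m + s}"
  proof
    fix c assume "c \<in> g ` {1..2 * n + 1}"
    then obtain v where v: "v \<in> {1..2 * n + 1}" "c = g v" by blast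
    show "c \<in> {1..m + s}"
    proof (cases "even v")
      case True
      then have "v div 2 \<in> {1..n}" using v by auto
      then have "f (v div 2) \<in> {1..m}" using colors by blast
      then show ?thesis using True v by (simp add: g_def)
    next
      case False
      then show ?thesis
        using v mod_less_divisor[OF \<open>0 < s\<close>, of "v div 2"] by (simp add: g_def)
    qed
  qed
  show "strong_cf (2 * s - 1) g 1 (Suc (2 * n + 1))"
    unfolding strong_cf_def
  proof (intro allI impI)
    fix i j :: nat
    assume ij: "1 \<le> i \<and> j \<le> Suc (2 * n + 1)"
    show "min (2 * s - 1) (j - i) \<le> card (solo g {i..<j})"
    proof (cases "i < j")
      case True
      define A where "A = {(i + 1) div 2..<(j + 1) div 2}"
      define B where "B = {i div 2..<j div 2}"
      have evens: "2 * x \<in> {i..<j} \<longleftrightarrow> x \<in> A" for x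
        unfolding A_def by auto
      have odds: "2 * x + 1 \<in> {i..<j} \<longleftrightarrow> x \<in> B" for x
        unfolding B_def by auto
      have "A \<subseteq> {1..n}"
        using ij unfolding A_def by auto
      then have old: "f x \<le> m" if "x \<in> A" for x
        using that colors by fastforce
      have e: "(\<lambda>x. 2 * x) ` solo f A \<subseteq> solo g {i..<j}"
      proof
        fix v assume "v \<in> (\<lambda>x. 2 * x) ` solo f A"
        then obtain x where x: "v = 2 * x" "x \<in> solo f A" by blast
        then have "x \<in> A" by (simp add: solo_def)
        have "w = v" if w: "w \<in> {i..<j}" "g w = g v" for w
        proof (cases "even w")
          case True
          then obtain y where y: "w = 2 * y" by blast
          then have "y \<in> A" "f y = f x"
            using w x evens by (auto simp: g_def)
          then show ?thesis using x y by (auto simp: solo_def)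
        next
          case False
          then show ?thesis
            using w x old[OF \<open>x \<in> A\<close>] by (simp add: g_def)
        qed
        then show "v \<in> solo g {i..<j}"
          using evens[of x] \<open>x \<in> A\<close> x(1) by (auto simp: solo_def)
      qed
      have o: "(\<lambda>x. 2 * x + 1) ` solo (\<lambda>x. x mod s) B \<subseteq> solo g {i..<j}"
      proof
        fix v assume "v \<in> (\<lambda>x. 2 * x + 1) ` solo (\<lambda>x. x mod s) B"
        then obtain x where x: "v = 2 * x + 1" "x \<in> solo (\<lambda>x. x mod s) B" by blast
        then have "x \<in> B" by (simp add: solo_def)
        have "w = v" if w: "w \<in> {i..<j}" "g w = g v" for w
        proof (cases "even w")
          case True
          then obtain y where y: "w = 2 * y" by blast
          then have "y \<in> A" using w evens by blast
          then show ?thesis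
            using w x y old[of y] by (simp add: g_def)
        next
          case False
          then obtain y where y: "w = 2 * y + 1" by (elim oddE)
          then have "y \<in> B" "y mod s = x mod s"
            using w x odds by (auto simp: g_def)
          then show ?thesis using x y by (auto simp: solo_def)
        qed
        then show "v \<in> solo g {i..<j}"
          using odds[of x] \<open>x \<in> B\<close> x(1) by (auto simp: solo_def)
      qed
      define a where "a = card A"
      define b where "b = card B"
      have half: "v div 2 + (v + 1) div 2 = v" "(v + 1) div 2 \<le> v div 2 + 1" for v :: nat
        by presburger+
      have "i div 2 \<le> j div 2" "(i + 1) div 2 \<le> (j + 1) div 2" "j div 2 \<le> (j + 1) div 2"
        using True by (auto intro: div_le_mono)
      then have len: "j - i = a + b" "b \<le> a + 1"
        using half[of i] half[of j]
        unfolding a_def b_def A_def B_def card_atLeastLessThan by linarith+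
      have cA: "min (2 * s - 1) a \<le> card (solo f A)"
      proof -
        have "1 \<le> (i + 1) div 2" "(j + 1) div 2 \<le> Suc n"
          using ij by auto
        then show ?thesis
          using cf unfolding strong_cf_def A_def a_def card_atLeastLessThan by blast
      qed
      have "B = {i div 2..<i div 2 + b}"
        unfolding b_def B_def card_atLeastLessThan by auto
      then have cB: "min b (2 * s - b) \<le> card (solo (\<lambda>x. x mod s) B)"
        using card_solo_mod[OF \<open>0 < s\<close>] by metis
      have fin: "finite (solo f A)" "finite (solo (\<lambda>x. x mod s) B)"
        by (simp_all add: finite_solo A_def B_def)
      have "card (solo f A) + card (solo (\<lambda>x. x mod s) B)
          = card ((\<lambda>x. 2 * x) ` solo f A) + card ((\<lambda>x. 2 * x + 1) ` solo (\<lambda>x. x mod s) B)"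
        by (simp add: card_image inj_on_def)
      also have "\<dots> = card ((\<lambda>x. 2 * x) ` solo f A \<union> (\<lambda>x. 2 * x + 1) ` solo (\<lambda>x. x mod s) B)"
        using fin by (intro card_Un_disjoint[symmetric]) (auto, presburger)
      also have "\<dots> \<le> card (solo g {i..<j})"
        using e o by (intro card_mono finite_solo) auto
      finally have "min (2 * s - 1) a + min b (2 * s - b) \<le> card (solo g {i..<j})"
        using cA cB by linarith
      \<comment> \<open>For \<open>a < 2 * s - 1\<close> and \<open>b > s\<close> this is \<open>a + (2 * s - b) \<ge> 2 * s - 1\<close>, from \<open>b \<le> a + 1\<close>.\<close>
      moreover have "min (2 * s - 1) (a + b) \<le> min (2 * s - 1) a + min b (2 * s - b)"
        using len(2) \<open>0 < s\<close> by (simp add: min_def) linarith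
      ultimately show ?thesis
        using len(1) by simp
    qed simp
  qed
qed

lemma strong_cf_exists:
  assumes "0 < s"
  shows "\<exists>f. f ` {1..2 * s * 2 ^ t - 1} \<subseteq> {1..2 * s - 1 + t * s} \<and>
    strong_cf (2 * s - 1) f 1 (2 * s * 2 ^ t)"
proof (induction t)
  case 0
  show ?case
    by (intro exI[of _ "\<lambda>v. v"]) (simp add: strong_cf_id)
next
  case (Suc t)
  define n where "n = 2 * s * 2 ^ t - 1"
  have "0 < 2 * s * 2 ^ t"
    using assms by simp
  then have n: "Suc n = 2 * s * 2 ^ t" "Suc (2 * n + 1) = 2 * s * 2 ^ Suc t"
    "2 * n + 1 = 2 * s * 2 ^ Suc t - 1"
    unfolding n_def power_Suc by linarith+
  obtain f where f: "f ` {1..n} \<subseteq> {1..2 * s - 1 + t * s}"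
    "strong_cf (2 * s - 1) f 1 (2 * s * 2 ^ t)"
    using Suc.IH unfolding n_def by blast
  have "2 * s - 1 + t * s + s = 2 * s - 1 + Suc t * s"
    by simp
  note double = strong_cf_double[OF f(2)[folded n(1)] assms f(1)]
  show ?case
    using double(2)[unfolded n(3) \<open>2 * s - 1 + t * s + s = _\<close>] double(1)[unfolded n(2)]
    by (intro exI conjI)
qed

section \<open>The chromatic number\<close>

lemma chi_kscf_interval_le:
  assumes "f ` {1..n} \<subseteq> {1..m}" "strong_cf k f 1 (Suc n)"
  shows "chi_kscf k (interval_hypergraph n) \<le> m"
  unfolding chi_kscf_def using assms kscf_coloring_interval_iff by (intro Least_le) blast

lemma chi_kscf_interval_attained:
  obtains f where "f ` {1..n} \<subseteq> {1..chi_kscf k (interval_hypergraph n)}"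
    "strong_cf k f 1 (Suc n)"
proof -
  have "kscf_coloring k (interval_hypergraph n) n (\<lambda>v. v)"
    by (simp add: kscf_coloring_interval_iff strong_cf_id)
  then have "\<exists>m f. kscf_coloring k (interval_hypergraph n) m f"
    by blast
  then have "\<exists>f. kscf_coloring k (interval_hypergraph n) (chi_kscf k (interval_hypergraph n)) f"
    unfolding chi_kscf_def by (rule LeastI_ex)
  then show ?thesis
    using that by (auto simp only: kscf_coloring_interval_iff)
qed

lemma chi_kscf_interval_mono:
  assumes "k \<le> k'"
  shows "chi_kscf k (interval_hypergraph n) \<le> chi_kscf k' (interval_hypergraph n)"
  using chi_kscf_interval_attained[of n k'] chi_kscf_interval_le strong_cf_antimono[OF _ assms]
  by metis

lemma chi_kscf_interval_lower:
  assumes "0 < s"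
  shows "real (2 * s - 1) + real s * (log 2 ((real n + 1) / (2 * real s)) - 1)
    < real (chi_kscf (2 * s - 1) (interval_hypergraph n))"
proof -
  let ?m = "chi_kscf (2 * s - 1) (interval_hypergraph n)"
  obtain f where f: "f ` {1..n} \<subseteq> {1..?m}" "strong_cf (2 * s - 1) f 1 (Suc n)"
    by (rule chi_kscf_interval_attained)
  have "card (f ` {1..<Suc n}) \<le> ?m"
    using card_mono[OF _ f(1)] by (simp add: atLeastLessThanSuc_atLeastAtMost)
  then have "real s * 2 powr ((real (card (f ` {1..<Suc n})) + 1) / real s)
      \<le> real s * 2 powr ((real ?m + 1) / real s)"
    by (intro mult_left_mono powr_mono divide_right_mono) auto
  then have "real n + 1 < real s * 2 powr ((real ?m + 1) / real s)"
    using strong_cf_length_bound[OF f(2) assms] by simp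
  then have "(real n + 1) / real s < 2 powr ((real ?m + 1) / real s)"
    using assms by (simp add: field_simps)
  then have "log 2 ((real n + 1) / real s) < (real ?m + 1) / real s"
    using assms by (subst log_less_iff) auto
  moreover have "log 2 ((real n + 1) / (2 * real s)) = log 2 ((real n + 1) / real s) - 1"
    using assms by (simp add: log_divide log_mult)
  ultimately have "log 2 ((real n + 1) / (2 * real s)) - 1 < (real ?m + 1) / real s - 2"
    by linarith
  then have "real s * (log 2 ((real n + 1) / (2 * real s)) - 1)
      < real s * ((real ?m + 1) / real s - 2)"
    using assms by (intro mult_strict_left_mono) auto
  also have "\<dots> = real ?m + 1 - 2 * real s"
    using assms by (simp add: field_simps)
  finally show ?thesis
    using assms by (simp add: of_nat_diff)
qed

lemma chi_kscf_interval_upper: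
  assumes "0 < s" "2 * s \<le> n"
  shows "real (chi_kscf (2 * s - 1) (interval_hypergraph n))
    < real (2 * s - 1) + real s * (1 + log 2 ((real n + 1) / (2 * real s)))"
proof -
  \<comment> \<open>The fewest doublings that reach length \<open>n\<close>; one less falls short, whence the strict bound.\<close>
  define P where "P t \<longleftrightarrow> Suc n \<le> 2 * s * 2 ^ t" for t
  define t where "t = (LEAST t. P t)"
  have "Suc n \<le> 2 * s * 2 ^ n"
    using assms less_exp[of n] by (metis Suc_leI le_trans mult_le_mono1 nat_mult_1 One_nat_def
        nat_0_less_mult_iff zero_less_numeral)
  then have "P t"
    unfolding t_def P_def[symmetric] by (rule LeastI)
  then have n: "Suc n \<le> 2 * s * 2 ^ t"
    by (simp add: P_def)
  then have "t \<noteq> 0"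
    using assms(2) by (intro notI) simp
  then obtain r where r: "t = Suc r"
    using not0_implies_Suc by blast
  then have "\<not> P r"
    unfolding t_def by (metis lessI not_less_Least)
  then have "2 * s * 2 ^ r < n + 1"
    by (simp add: P_def)
  then have "real (2 * s * 2 ^ r) < real (n + 1)"
    by (simp only: of_nat_less_iff)
  then have "2 ^ r < (real n + 1) / (2 * real s)"
    using assms by (simp add: field_simps)
  then have "real r < log 2 ((real n + 1) / (2 * real s))"
    using assms by (subst less_log_iff) (auto simp: powr_realpow)
  then have "real s * real t < real s * (1 + log 2 ((real n + 1) / (2 * real s)))"
    using assms r by simp
  moreover have "chi_kscf (2 * s - 1) (interval_hypergraph n) \<le> 2 * s - 1 + t * s"
  proof -
    obtain f where f: "f ` {1..2 * s * 2 ^ t - 1} \<subseteq> {1..2 * s - 1 + t * s}"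
      "strong_cf (2 * s - 1) f 1 (2 * s * 2 ^ t)"
      using strong_cf_exists[OF assms(1)] by blast
    have "f ` {1..n} \<subseteq> f ` {1..2 * s * 2 ^ t - 1}"
      using n by (intro image_mono) auto
    then show ?thesis
      using f(1) strong_cf_subinterval[OF f(2) order_refl n]
      by (intro chi_kscf_interval_le) auto
  qed
  then have "real (chi_kscf (2 * s - 1) (interval_hypergraph n))
      \<le> real (2 * s - 1) + real s * real t"
    by (metis of_nat_le_iff of_nat_add of_nat_mult mult.commute)
  ultimately show ?thesis
    by linarith
qed

theorem corollary2p10:
  "(\<forall>k n :: nat. k > 0 \<and> odd k \<and> n \<ge> k + 1 \<longrightarrow>
      real k + (real k + 1) / 2 * (log 2 ((real n + 1) / (real k + 1)) - 1)
        < real (chi_kscf k (interval_hypergraph n)) \<and>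
      real (chi_kscf k (interval_hypergraph n))
        < real k + (real k + 1) / 2 * (1 + log 2 ((real n + 1) / (real k + 1)))) \<and>
   (\<forall>k n :: nat. k > 0 \<and> even k \<and> n \<ge> k + 2 \<longrightarrow>
      real k - 1 + real k / 2 * (log 2 ((real n + 1) / real k) - 1)
        < real (chi_kscf k (interval_hypergraph n)) \<and>
      real (chi_kscf k (interval_hypergraph n))
        < 1 + real k + (real k + 2) / 2 * (1 + log 2 ((real n + 1) / (real k + 2))))"
proof (intro conjI allI impI; elim conjE)
  fix k n :: nat
  assume k: "odd k" "n \<ge> k + 1"
  define s where "s = (k + 1) div 2"
  have s: "k = 2 * s - 1" "0 < s" "2 * s \<le> n" "real k + 1 = 2 * real s"
    using k unfolding s_def by (auto elim!: oddE)
  show "real k + (real k + 1) / 2 * (log 2 ((real n + 1) / (real k + 1)) - 1)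
      < real (chi_kscf k (interval_hypergraph n))"
    using chi_kscf_interval_lower[OF s(2), of n] unfolding s(4) s(1)[symmetric] by simp
  show "real (chi_kscf k (interval_hypergraph n))
      < real k + (real k + 1) / 2 * (1 + log 2 ((real n + 1) / (real k + 1)))"
    using chi_kscf_interval_upper[OF s(2,3)] unfolding s(4) s(1)[symmetric] by simp
next
  fix k n :: nat
  assume k: "k > 0" "even k" "n \<ge> k + 2"
  define s where "s = k div 2"
  have s: "0 < s" "k = 2 * s" "2 * (s + 1) - 1 = k + 1"
    using k unfolding s_def by (auto elim!: evenE)
  have "real (chi_kscf (2 * s - 1) (interval_hypergraph n))
      \<le> real (chi_kscf k (interval_hypergraph n))"
    using s by (intro of_nat_mono chi_kscf_interval_mono) auto
  then show "real k - 1 + real k / 2 * (log 2 ((real n + 1) / real k) - 1)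
      < real (chi_kscf k (interval_hypergraph n))"
    using chi_kscf_interval_lower[OF s(1), of n] s(1) by (simp add: s(2) of_nat_diff)
  have "real (chi_kscf k (interval_hypergraph n))
      \<le> real (chi_kscf (2 * (s + 1) - 1) (interval_hypergraph n))"
    using s by (intro of_nat_mono chi_kscf_interval_mono) auto
  also have "\<dots> < real (2 * (s + 1) - 1)
      + real (s + 1) * (1 + log 2 ((real n + 1) / (2 * real (s + 1))))"
    using k s by (intro chi_kscf_interval_upper) auto
  also have "\<dots> = 1 + real k + (real k + 2) / 2 * (1 + log 2 ((real n + 1) / (real k + 2)))"
    unfolding s(3) by (simp add: s(2) add_divide_distrib distrib_left add.commute)
  finally show "real (chi_kscf k (interval_hypergraph n))
      < 1 + real k + (real k + 2) / 2 * (1 + log 2 ((real n + 1) / (real k + 2)))" .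
qed

end
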